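(* As $v\to\infty$ with $v\equiv 3\pmod 6$, there is a Steiner triple system of order $v$ that contains at most $o(v)$ disjoint parallel classes. That is, there is a function $h$ from the set of positive integers $v\equiv 3\pmod 6$ to the nonnegative real numbers with $h(v)/v\to 0$ as $v\to\infty$ such that, for every sufficiently large $v\equiv 3\pmod 6$, there is a Steiner triple system of order $v$ in which every set of pairwise disjoint parallel classes has at most $h(v)$ members.
   Context: A Steiner triple system of order $v$ is a pair $(V,\mathcal{B})$ where $V$ is a set of $v$ points and $\mathcal{B}$ is a collection of $3$-subsets of $V$ (triples) such that any two distinct points occur together in exactly one triple. For $v\equiv 3\pmod 6$, a parallel class is a set of $v/3$ pairwise disjoint triples in $\mathcal{B}$ (so its triples partition $V$). Two parallel classes are disjoint if they have no triple in common. *)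

theory Defs
  imports Complex_Main
begin

definition steiner_triple_system :: "'a set \<Rightarrow> 'a set set \<Rightarrow> bool" where
  "steiner_triple_system V B \<longleftrightarrow>
     finite V \<and>
     (\<forall>T\<in>B. T \<subseteq> V \<and> card T = 3) \<and>
     (\<forall>x\<in>V. \<forall>y\<in>V. x \<noteq> y \<longrightarrow> (\<exists>!T. T \<in> B \<and> {x, y} \<subseteq> T))"

text \<open>The last conjunct says that the number of triples is \<open>v / 3\<close>, where \<open>v = card V\<close>,
  without truncating division. In a Steiner triple system \<open>P\<close> is automatically finite.\<close>

definition parallel_class :: "'a set \<Rightarrow> 'a set set \<Rightarrow> 'a set set \<Rightarrow> bool" where
  "parallel_class V B P \<longleftrightarrow> P \<subseteq> B \<and> pairwise disjnt P \<and> 3 * card P = card V"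

definition disjoint_parallel_classes :: "'a set \<Rightarrow> 'a set set \<Rightarrow> 'a set set set \<Rightarrow> bool" where
  "disjoint_parallel_classes V B \<P> \<longleftrightarrow> (\<forall>P\<in>\<P>. parallel_class V B P) \<and> pairwise disjnt \<P>"

text \<open>The filter expressing \<open>v \<rightarrow> \<infinity>\<close> along \<open>v \<equiv> 3 (mod 6)\<close>.\<close>

definition at_top_3_mod_6 :: "nat filter" where
  "at_top_3_mod_6 = inf at_top (principal {v. v mod 6 = 3})"

end

theory Submission
  imports Defs "HOL-Real_Asymp.Real_Asymp"
begin

text \<open>
  Let \<open>v\<close> be \<open>3\<close> modulo \<open>6\<close>, so that \<open>n = v - 2\<close> is coprime to \<open>6\<close>, and let \<open>G\<close> be a cyclic group of order
  \<open>n\<close>, written multiplicatively. The construction refines that of Schreiber and Wilson. The points are the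
  nonidentity elements of \<open>G\<close> and three special points: one in the role of the identity, and two points at
  infinity. Most triples are the sets of three distinct nonidentity elements with product \<open>1\<close>. The pairs
  that they miss are the edges \<open>{x, inverse x}\<close> (rungs) and \<open>{x, inverse (x * x)}\<close> (arcs) of a cubic graph.
  For any proper \<open>3\<close>-edge-colouring of this graph, joining every edge to the special point of its colour,
  and adding the triple of special points, gives a Steiner triple system (\<open>steiner\<close>).

  Suppose that all rungs had the colour of the identity, and that arcs starting at mutually inverse
  elements had the same colour. The product of all elements of \<open>G\<close> is \<open>1\<close>. A parallel class without the triple
  of special points has exactly two triples whose elements do not multiply to \<open>1\<close>: those through
  the points at infinity, where the arcs started by \<open>x\<close> and \<open>y\<close> contribute \<open>inverse x\<close> and
  \<open>inverse y\<close>. Hence \<open>y = inverse x\<close>, but the two arcs have different colours, a contradiction. All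
  parallel classes would therefore contain the triple of special points, and no two would be disjoint.

  Such a colouring amounts to a two-colouring of the elements that is invariant under inversion
  and alternates along the orbits of squaring. Up to inversion these orbits are cycles, and an odd cycle
  obstructs alternation. One defect for every odd cycle suffices, however: at a defect the colour of
  the identity can be moved from two rungs to the two arcs between them, and this
  creates only a bounded number of triples for which the argument above fails
  (\<open>few_parallel_classes\<close>). Disjoint parallel classes using such triples use different ones, so the number of
  disjoint parallel classes is bounded by a constant times the number of defects, plus one.

  It remains to see that there are few orbits. A two-colouring with as few defects as possible has at
  most one defect, up to inversion, on each orbit (\<open>separated_defects_exist\<close>). An element whose orbit has
  length \<open>l\<close> up to inversion is a root of unity of order dividing \<open>2 ^ l - 1\<close> or \<open>2 ^ l + 1\<close>; so at most
  \<open>2 ^ (L + 1)\<close> elements lie on orbits of length below \<open>L\<close>, while longer orbits account for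
  \<open>O(n / L)\<close> defects (\<open>card_separated_set\<close>). Taking \<open>L\<close> close to half the binary logarithm of \<open>v\<close> leaves
  \<open>O(v / log v)\<close> disjoint parallel classes.
\<close>

section \<open>Finite groups of complex numbers of order coprime to six\<close>

text \<open>
  The group is written multiplicatively inside \<open>\<complex>\<close>, so that relations between its elements are
  equations in a field; a finite such group is the group of \<open>n\<close>-th roots of unity for some \<open>n\<close>.
  The last two assumptions say that \<open>n\<close> is coprime to \<open>2\<close> and to \<open>3\<close>.
\<close>
locale unit_group =
  fixes G :: "complex set"
  assumes finite_G: "finite G"
    and zero_notin: "0 \<notin> G"
    and one_in: "1 \<in> G"
    and mult_in: "\<lbrakk>x \<in> G; y \<in> G\<rbrakk> \<Longrightarrow> x * y \<in> G"
    and inverse_in: "x \<in> G \<Longrightarrow> inverse x \<in> G"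
    and square_one: "\<lbrakk>x \<in> G; x * x = 1\<rbrakk> \<Longrightarrow> x = 1"
    and cube_one: "\<lbrakk>x \<in> G; x * x * x = 1\<rbrakk> \<Longrightarrow> x = 1"
begin

abbreviation G1 :: "complex set" where "G1 \<equiv> G - {1}"

lemma nonzero: "x \<in> G \<Longrightarrow> x \<noteq> 0"
  using zero_notin by blast

lemma prod_in: "(\<And>x. x \<in> A \<Longrightarrow> f x \<in> G) \<Longrightarrow> prod f A \<in> G"
  by (induction A rule: infinite_finite_induct) (auto intro: one_in mult_in)

lemma power_in: "x \<in> G \<Longrightarrow> x ^ k \<in> G"
  by (induction k) (auto intro: one_in mult_in)

text \<open>
  Inversion permutes the factors, so the product is its own inverse, and there is no involution.
\<close>
lemma prod_G: "\<Prod>G = 1"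
proof -
  have "\<Prod>G = prod inverse G"
    by (rule prod.reindex_bij_witness[of _ inverse inverse]) (auto intro: inverse_in)
  also have "\<dots> = inverse (\<Prod>G)"
    using prod_inversef[of "\<lambda>x. x" G] by (simp add: comp_def)
  finally have *: "\<Prod>G = inverse (\<Prod>G)" .
  have "\<Prod>G \<in> G" by (rule prod_in)
  moreover from this have "\<Prod>G * \<Prod>G = 1"
    using right_inverse[OF nonzero] * by metis
  ultimately show ?thesis by (rule square_one)
qed

lemma square_inj: "\<lbrakk>x \<in> G; y \<in> G; x * x = y * y\<rbrakk> \<Longrightarrow> x = y"
proof -
  assume *: "x \<in> G" "y \<in> G" "x * x = y * y"
  then have "(x * inverse y) * (x * inverse y) = 1"
    using nonzero[of y] by (simp add: field_simps)
  then have "x * inverse y = 1"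
    using * by (auto intro: square_one mult_in inverse_in)
  then show "x = y"
    using nonzero[OF \<open>y \<in> G\<close>] by (simp add: field_simps)
qed

text \<open>
  Repeated squaring is the dynamics behind the whole construction; injectivity makes its orbits cycles.
\<close>
lemma pow2_inj:
  assumes "x \<in> G" "y \<in> G" "x ^ 2 ^ k = y ^ 2 ^ k"
  shows "x = y"
  using assms(3)
proof (induction k)
  case (Suc k)
  have "x ^ 2 ^ k * x ^ 2 ^ k = y ^ 2 ^ k * y ^ 2 ^ k"
    using Suc.prems by (simp add: mult_2 power_add)
  then have "x ^ 2 ^ k = y ^ 2 ^ k"
    by (rule square_inj[rotated 2]) (use assms in \<open>auto intro: power_in\<close>)
  then show ?case by (rule Suc.IH)
qed simp

lemma square_surj: "x \<in> G \<Longrightarrow> \<exists>u\<in>G. u * u = x"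
proof -
  assume "x \<in> G"
  have "inj_on (\<lambda>u. u * u) G" by (rule inj_onI) (rule square_inj)
  then have "(\<lambda>u. u * u) ` G = G"
    using finite_G mult_in by (intro card_subset_eq) (auto simp: card_image)
  with \<open>x \<in> G\<close> have "x \<in> (\<lambda>u. u * u) ` G" by simp
  then show ?thesis by blast
qed

definition rt :: "complex \<Rightarrow> complex" where
  "rt x = (THE u. u \<in> G \<and> u * u * x = 1)"

lemma rt_eqI: "\<lbrakk>x \<in> G; u \<in> G; u * u * x = 1\<rbrakk> \<Longrightarrow> rt x = u"
proof -
  assume u: "x \<in> G" "u \<in> G" "u * u * x = 1"
  have "w = u" if w: "w \<in> G" "w * w * x = 1" for w
  proof (rule square_inj)
    have "w * w * x = u * u * x" using u w by simp
    then show "w * w = u * u" using nonzero[OF u(1)] by simp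
  qed (use u w in auto)
  with u show "rt x = u" unfolding rt_def by blast
qed

lemma rt: assumes "x \<in> G1" shows "rt x \<in> G1" "rt x * rt x * x = 1"
proof -
  obtain u where u: "u \<in> G" "u * u = inverse x"
    using square_surj[of "inverse x"] assms inverse_in by auto
  then have "u * u * x = 1" using assms nonzero by simp
  moreover then have "rt x = u" using assms u by (intro rt_eqI) auto
  ultimately show "rt x \<in> G1" "rt x * rt x * x = 1" using u assms by auto
qed

end

section \<open>Triple systems from edge colourings of a cubic graph\<close>

text \<open>
  The three special points carry the three colours; the colour \<open>None\<close> plays the role of the identity
  of the group and the other two that of two points at infinity.
\<close>
datatype 'a point = Elem 'a | Special "bool option"

text \<open>
  On two distinct colours this is the remaining one.
\<close>
fun residual :: "bool option \<Rightarrow> bool option \<Rightarrow> bool option" where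
  "residual None (Some c) = Some (\<not> c)"
| "residual (Some c) None = Some (\<not> c)"
| "residual _ _ = None"

text \<open>
  On the nonidentity elements \<open>x\<close> consider the graph with rungs \<open>{x, inverse x}\<close> and arcs
  \<open>{x, inverse (x * x)}\<close>. It is cubic: besides its rung, \<open>x\<close> meets the arc that it starts and the arc
  that it ends. Its edges are exactly the pairs \<open>{x, y}\<close> for which \<open>inverse (x * y)\<close> is \<open>1\<close> or one of
  \<open>x\<close> and \<open>y\<close>, that is, the pairs that cannot be completed to three distinct nonidentity
  elements with product \<open>1\<close>. The assumptions describe a proper edge colouring: \<open>arc x\<close> is the colour of
  the arc started by \<open>x\<close>, and \<open>rung x\<close> that of the rung through \<open>x\<close>.
\<close>
locale coloured_ladder = unit_group +
  fixes arc rung :: "complex \<Rightarrow> bool option"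
  assumes rung_sym: "\<lbrakk>x \<in> G1; y \<in> G1; x * y = 1\<rbrakk> \<Longrightarrow> rung x = rung y"
    and arc_rung_tail: "x \<in> G1 \<Longrightarrow> arc x \<noteq> rung x"
    and arc_rung_head: "\<lbrakk>x \<in> G1; y \<in> G1; x * x * y = 1\<rbrakk> \<Longrightarrow> arc x \<noteq> rung y"
    and arc_arc: "\<lbrakk>x \<in> G1; y \<in> G1; x * x * y = 1\<rbrakk> \<Longrightarrow> arc x \<noteq> arc y"
begin

definition points :: "complex point set" where
  "points = Elem ` G1 \<union> range Special"

definition flat_triples :: "complex point set set" where
  "flat_triples = {{Elem x, Elem y, Elem z} | x y z.
     x \<in> G1 \<and> y \<in> G1 \<and> z \<in> G1 \<and> x \<noteq> y \<and> y \<noteq> z \<and> z \<noteq> x \<and> x * y * z = 1}"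

definition arc_triples :: "complex point set set" where
  "arc_triples = {{Special (arc x), Elem x, Elem y} | x y.
     x \<in> G1 \<and> y \<in> G1 \<and> x * x * y = 1}"

definition rung_triples :: "complex point set set" where
  "rung_triples = {{Special (rung x), Elem x, Elem y} | x y.
     x \<in> G1 \<and> y \<in> G1 \<and> x * y = 1}"

definition triples :: "complex point set set" where
  "triples = insert (range Special) (flat_triples \<union> arc_triples \<union> rung_triples)"

text \<open>
  The third point of the triple through two distinct points. At a special point \<open>i\<close> and an element
  \<open>x\<close>, the last case is the one where \<open>i\<close> is the colour of the arc that ends at \<open>x\<close>.
\<close>
fun third :: "complex point \<Rightarrow> complex point \<Rightarrow> complex point" where
  "third (Special i) (Special j) = Special (residual i j)"
| "third (Special i) (Elem x) = Elem
     (if i = rung x then inverse x else if i = arc x then inverse (x * x) else rt x)"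
| "third (Elem x) (Special i) = Elem
     (if i = rung x then inverse x else if i = arc x then inverse (x * x) else rt x)"
| "third (Elem x) (Elem y) =
     (if x * y = 1 then Special (rung x)
      else if x * x * y = 1 then Special (arc x)
      else if y * y * x = 1 then Special (arc y)
      else Elem (inverse (x * y)))"

lemma range_Special: "range Special = {Special None, Special (Some False), Special (Some True)}"
  by (simp add: UNIV_option_conv UNIV_bool insert_commute)

lemma arc_ends_distinct:
  assumes "x \<in> G1" "y \<in> G1" "x * x * y = 1"
  shows "x \<noteq> y" "x * y \<noteq> 1" "y * y * x \<noteq> 1"
proof -
  show "x \<noteq> y" using assms cube_one by auto
  show "x * y \<noteq> 1"
  proof
    assume "x * y = 1"
    then have "x * x * y = x" by (simp add: mult.assoc)
    with assms show False by simp
  qed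
  show "y * y * x \<noteq> 1"
  proof
    assume "y * y * x = 1"
    then have "x * y * x = x * y * y" using assms by (simp add: mult_ac)
    then have "x = y" using assms nonzero by auto
    with assms cube_one show False by auto
  qed
qed

lemma rung_ends_distinct:
  assumes "x \<in> G1" "y \<in> G1" "x * y = 1"
  shows "x \<noteq> y" "x * x * y \<noteq> 1" "y * y * x \<noteq> 1"
proof -
  show "x \<noteq> y" using assms square_one by auto
  have "y * x = 1" using assms(3) by (simp add: mult.commute)
  then have *: "x * x * y = x" "y * y * x = y"
    using assms(3) by (simp_all add: mult.assoc)
  show "x * x * y \<noteq> 1" "y * y * x \<noteq> 1"
    unfolding * using assms(1,2) by simp_all
qed

lemma triple_points:
  assumes "T \<in> triples"
  shows "T \<subseteq> points \<and> card T = 3"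
proof -
  have "T \<subseteq> points \<and> card T = 3" if "T \<in> flat_triples"
    using that by (auto simp: flat_triples_def points_def)
  moreover have "T \<subseteq> points \<and> card T = 3" if "T \<in> arc_triples"
    using that by (auto simp: arc_triples_def points_def dest: arc_ends_distinct(1)[rotated 2])
  moreover have "T \<subseteq> points \<and> card T = 3" if "T \<in> rung_triples"
    using that by (auto simp: rung_triples_def points_def dest: rung_ends_distinct(1)[rotated 2])
  ultimately show ?thesis
    using assms by (auto simp: triples_def points_def range_Special)
qed

lemma flatI:
  assumes "x \<in> G1" "y \<in> G1" "z \<in> G1" "x \<noteq> y" "y \<noteq> z" "z \<noteq> x" "x * y * z = 1"
  shows "{Elem x, Elem y, Elem z} \<in> triples"
  using assms unfolding triples_def flat_triples_def by blast

lemma arcI: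
  assumes "x \<in> G1" "y \<in> G1" "x * x * y = 1"
  shows "{Special (arc x), Elem x, Elem y} \<in> triples"
  using assms unfolding triples_def arc_triples_def by blast

lemma rungI:
  assumes "x \<in> G1" "y \<in> G1" "x * y = 1"
  shows "{Special (rung x), Elem x, Elem y} \<in> triples"
  using assms unfolding triples_def rung_triples_def by blast

lemma third_Elem_Special: "third (Elem x) (Special i) = third (Special i) (Elem x)"
  by simp

text \<open>
  An edge of the cubic graph lies in the triple of its colour, and any other pair of elements in a flat
  triple. For a special point and an element \<open>x\<close>, properness is what counts: three distinct colours at
  \<open>x\<close> exhaust the three special points.
\<close>
lemma third_triple:
  assumes "p \<in> points" "q \<in> points" "p \<noteq> q"
  shows "{p, q, third p q} \<in> triples"
proof -
  have ES: "{Special i, Elem x, third (Special i) (Elem x)} \<in> triples" if x: "x \<in> G1" for i x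
  proof -
    consider "i = rung x" | "i \<noteq> rung x" "i = arc x" | "i \<noteq> rung x" "i \<noteq> arc x" by blast
    then show ?thesis
    proof cases
      case 1
      have "inverse x \<in> G1" "x * inverse x = 1"
        using x inverse_in nonzero[of x] by auto
      from rungI[OF x this] 1 show ?thesis by simp
    next
      case 2
      have "x * x \<noteq> 1" using x square_one by auto
      then have "inverse (x * x) \<in> G1"
        using x inverse_in[OF mult_in, of x x] by (auto simp del: inverse_mult_distrib)
      moreover have "x * x * inverse (x * x) = 1"
        using x nonzero[of x] by (simp add: field_simps)
      ultimately show ?thesis using arcI[OF x] 2 by simp
    next
      case 3
      note r = rt[OF x]
      have "arc (rt x) \<noteq> rung x" "arc (rt x) \<noteq> arc x" "arc x \<noteq> rung x"
        using r x arc_rung_head arc_arc arc_rung_tail by auto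
      then have "i = arc (rt x)" using 3
        by (cases i; cases "arc (rt x)"; cases "arc x"; cases "rung x") auto
      then show ?thesis using 3 arcI[OF r(1) x r(2)] by (simp add: insert_commute)
    qed
  qed
  have EE: "{Elem x, Elem y, third (Elem x) (Elem y)} \<in> triples"
    if xy: "x \<in> G1" "y \<in> G1" "x \<noteq> y" for x y
  proof -
    consider "x * y = 1" | "x * y \<noteq> 1" "x * x * y = 1"
      | "x * y \<noteq> 1" "x * x * y \<noteq> 1" "y * y * x = 1"
      | "x * y \<noteq> 1" "x * x * y \<noteq> 1" "y * y * x \<noteq> 1" by blast
    then show ?thesis
    proof cases
      case 1
      then show ?thesis using rungI[OF xy(1,2)] by (simp add: insert_commute)
    next
      case 2
      then show ?thesis using arcI[OF xy(1,2)] by (simp add: insert_commute)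
    next
      case 3
      then show ?thesis using arcI[OF xy(2,1)] by (simp add: insert_commute)
    next
      case 4
      define z where "z = inverse (x * y)"
      have nz: "x \<noteq> 0" "y \<noteq> 0" using xy nonzero by auto
      have z: "z \<in> G1"
        using xy 4 inverse_in[OF mult_in, of x y] unfolding z_def
        by (auto simp del: inverse_mult_distrib)
      have xyz: "x * y * z = 1" using nz by (simp add: z_def field_simps)
      have "z \<noteq> x" "z \<noteq> y" using xyz 4 by (auto simp: mult_ac)
      then show ?thesis using flatI[OF xy(1,2) z xy(3) _ _ xyz] 4 by (simp add: z_def)
    qed
  qed
  show ?thesis
  proof (cases p; cases q)
    fix i j assume "p = Special i" "q = Special j"
    with assms have "{p, q, third p q} = range Special"
      by (cases i; cases j) (auto simp: range_Special)
    then show ?thesis by (simp add: triples_def)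
  next
    fix i x assume "p = Special i" "q = Elem x"
    with assms ES[of x i] show ?thesis by (auto simp: points_def simp del: third.simps)
  next
    fix i x assume "p = Elem x" "q = Special i"
    with assms ES[of x i] show ?thesis
      by (auto simp: points_def insert_commute third_Elem_Special simp del: third.simps)
  next
    fix x y assume "p = Elem x" "q = Elem y"
    with assms EE[of x y] show ?thesis by (auto simp: points_def simp del: third.simps)
  qed
qed

text \<open>
  This gives uniqueness: whichever pair is taken from a triple, the triple is recovered from it.
\<close>
lemma triple_eq_third:
  assumes "T \<in> triples" "p \<in> T" "q \<in> T" "p \<noteq> q"
  shows "T = {p, q, third p q}"
proof -
  consider "T = range Special" | "T \<in> flat_triples" | "T \<in> arc_triples" | "T \<in> rung_triples"
    using assms(1) by (auto simp: triples_def)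
  then show ?thesis
  proof cases
    case 1
    then show ?thesis using assms(2-4) by (auto simp: range_Special)
  next
    case 2
    then obtain x y z where T: "T = {Elem x, Elem y, Elem z}" and
      xyz: "x \<in> G1" "y \<in> G1" "z \<in> G1" "x \<noteq> y" "y \<noteq> z" "z \<noteq> x" "x * y * z = 1"
      by (auto simp: flat_triples_def)
    have *: "third (Elem a) (Elem b) = Elem c"
      if "a \<in> G1" "b \<in> G1" "c \<in> G1" "a \<noteq> b" "b \<noteq> c" "c \<noteq> a" "a * b * c = 1" for a b c
    proof -
      have nz: "a \<noteq> 0" "b \<noteq> 0" using that nonzero by auto
      have c: "c = inverse (a * b)" using that by (metis inverse_unique)
      have "a * b \<noteq> 1" using that by auto
      moreover have "a * a * b \<noteq> 1" "b * b * a \<noteq> 1"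
        using that nz by (auto simp: c field_simps)
      ultimately show ?thesis by (simp add: c)
    qed
    have perms: "x * z * y = 1" "y * x * z = 1" "y * z * x = 1" "z * x * y = 1" "z * y * x = 1"
      using xyz(7) by (simp_all add: mult_ac)
    show ?thesis
      using assms(2-4) xyz perms unfolding T
      by (elim insertE emptyE) (simp_all add: * insert_commute del: third.simps)
  next
    case 3
    then obtain x y where T: "T = {Special (arc x), Elem x, Elem y}" and
      xy: "x \<in> G1" "y \<in> G1" "x * x * y = 1"
      by (auto simp: arc_triples_def)
    note d = arc_ends_distinct[OF xy]
    have y: "y = inverse (x * x)" using xy(3) by (metis inverse_unique)
    have r: "rt y = x" using xy by (intro rt_eqI) auto
    have "third (Elem x) (Elem y) = Special (arc x)" "third (Elem y) (Elem x) = Special (arc x)"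
      using xy d by (auto simp: mult.commute)
    moreover have "third (Special (arc x)) (Elem x) = Elem y"
      using arc_rung_tail[OF xy(1)] by (simp add: y)
    moreover have "third (Special (arc x)) (Elem y) = Elem x"
      using arc_rung_head[OF xy] arc_arc[OF xy] r by simp
    ultimately show ?thesis using assms(2-4) unfolding T
      by (elim insertE emptyE) (simp_all add: insert_commute third_Elem_Special del: third.simps)
  next
    case 4
    then obtain x y where T: "T = {Special (rung x), Elem x, Elem y}" and
      xy: "x \<in> G1" "y \<in> G1" "x * y = 1"
      by (auto simp: rung_triples_def)
    have y: "y = inverse x" "x = inverse y"
      using xy(3) by (metis inverse_unique, metis inverse_unique mult.commute)
    have s: "rung y = rung x" using rung_sym xy by metis
    have "third (Elem x) (Elem y) = Special (rung x)" "third (Elem y) (Elem x) = Special (rung x)"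
      using xy s by (simp_all add: mult.commute)
    moreover have "third (Special (rung x)) (Elem x) = Elem y"
      by (simp add: y(1))
    moreover have "third (Special (rung x)) (Elem y) = Elem x"
      using y(2) s by simp
    ultimately show ?thesis using assms(2-4) unfolding T
      by (elim insertE emptyE) (simp_all add: insert_commute third_Elem_Special del: third.simps)
  qed
qed

lemma steiner: "steiner_triple_system points triples"
  unfolding steiner_triple_system_def
proof (intro conjI ballI impI)
  show "finite points"
    using finite_G by (simp add: points_def)
next
  fix p q assume pq: "p \<in> points" "q \<in> points" "p \<noteq> q"
  show "\<exists>!T. T \<in> triples \<and> {p, q} \<subseteq> T"
  proof (rule ex1I)
    show "{p, q, third p q} \<in> triples \<and> {p, q} \<subseteq> {p, q, third p q}"
      using third_triple[OF pq] by simp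
    show "T = {p, q, third p q}" if "T \<in> triples \<and> {p, q} \<subseteq> T" for T
      using that pq triple_eq_third[of T p q] by (simp del: third.simps)
  qed
qed (simp_all add: triple_points)

lemma card_points: "card points = card G + 2"
proof -
  have "card points = card (Elem ` G1) + card (range Special :: complex point set)"
    unfolding points_def using finite_G by (intro card_Un_disjoint) auto
  also have "\<dots> = (card G - 1) + 3"
    using one_in by (simp add: card_image inj_on_def range_Special)
  finally show ?thesis
    using card_gt_0_iff[of G] one_in finite_G by (cases "card G") auto
qed

end

section \<open>Parallel classes and products of group elements\<close>
lemma parallel_class_covers:
  assumes "steiner_triple_system V B" "parallel_class V B P" "V \<noteq> {}"
  shows "finite P" "\<Union>P = V"
proof -
  have V: "finite V" and B: "\<And>T. T \<in> B \<Longrightarrow> T \<subseteq> V \<and> card T = 3"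
    and P: "P \<subseteq> B" "pairwise disjnt P" "3 * card P = card V"
    using assms by (auto simp: steiner_triple_system_def parallel_class_def)
  have "card V > 0" using V assms(3) by (simp add: card_gt_0_iff)
  then show "finite P" using P(3) card_gt_0_iff[of P] by linarith
  have "card (\<Union>P) = sum card P"
    using P B V by (intro card_Union_disjoint) (auto intro: finite_subset)
  also have "\<dots> = card V" using P B by (simp add: subset_eq)
  finally show "\<Union>P = V"
    using P B V by (intro card_subset_eq) auto
qed

text \<open>
  Disjoint classes choose distinct members of a set that all of them meet.
\<close>
lemma disjoint_classes_le_transversal:
  assumes "disjoint_parallel_classes V B \<P>" "finite E"
    and meets: "\<And>P. parallel_class V B P \<Longrightarrow> P \<inter> E \<noteq> {}"
  shows "card \<P> \<le> card E"
proof -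
  have "\<forall>P\<in>\<P>. \<exists>T. T \<in> P \<inter> E"
    using assms by (auto simp: disjoint_parallel_classes_def)
  then obtain f where f: "\<And>P. P \<in> \<P> \<Longrightarrow> f P \<in> P \<inter> E"
    by metis
  have "inj_on f \<P>"
  proof (rule inj_onI)
    fix P Q assume PQ: "P \<in> \<P>" "Q \<in> \<P>" "f P = f Q"
    then have "\<not> disjnt P Q" using f[of P] f[of Q] by (auto simp: disjnt_iff)
    then show "P = Q"
      using assms(1) PQ by (auto simp: disjoint_parallel_classes_def pairwise_def)
  qed
  then show ?thesis
    using f assms(2) by (intro card_inj_on_le[of f]) auto
qed

fun val :: "complex point \<Rightarrow> complex" where
  "val (Elem x) = x"
| "val (Special i) = 1"

context coloured_ladder
begin

text \<open>
  The triples that spoil the product argument below: an arc coloured \<open>None\<close> gives a triple whose product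
  is not \<open>1\<close>, and a rung with another colour, or the triple of special points, occupies a point at
  infinity without contributing to the product.
\<close>
definition exceptional :: "complex point set set" where
  "exceptional = insert (range Special)
     ({{Special None, Elem x, Elem (inverse (x * x))} | x. x \<in> G1 \<and> arc x = None} \<union>
      {{Special (rung x), Elem x, Elem (inverse x)} | x. x \<in> G1 \<and> rung x \<noteq> None})"

lemma prod_val_points: "prod val points = 1"
proof -
  have "prod val points = prod val (Elem ` G1) * prod val (range Special)"
    unfolding points_def using finite_G by (intro prod.union_disjoint) (auto simp: range_Special)
  also have "prod val (range Special) = 1"
    by (simp add: range_Special)
  also have "prod val (Elem ` G1) = \<Prod>G1"
    by (subst prod.reindex) (auto simp: inj_on_def)
  also have "\<dots> = \<Prod>G"
    using finite_G by (simp add: prod.remove[OF finite_G one_in])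
  finally show ?thesis using prod_G by simp
qed

text \<open>
  Every ordinary triple has product \<open>1\<close> except those at the two points at infinity; these contain an
  arc \<open>{x, inverse (x * x)}\<close>, which contributes \<open>inverse x\<close>.
\<close>
lemma ordinary_triple_cases:
  assumes "T \<in> triples" "T \<notin> exceptional"
  obtains (arc) x c where "x \<in> G1" "arc x = Some c" "Special (Some c) \<in> T"
      "\<And>d. Special (Some d) \<in> T \<Longrightarrow> d = c" "prod val T = inverse x"
  | (other) "\<And>c. Special (Some c) \<notin> T" "prod val T = 1"
proof -
  consider "T \<in> flat_triples" | "T \<in> arc_triples" | "T \<in> rung_triples"
    using assms by (auto simp: triples_def exceptional_def)
  then show ?thesis
  proof cases
    case 1
    then have "prod val T = 1" "\<And>c. Special (Some c) \<notin> T"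
      by (auto simp: flat_triples_def mult.assoc)
    then show ?thesis by (rule other[rotated])
  next
    case 2
    then obtain x y where T: "T = {Special (arc x), Elem x, Elem y}"
      and xy: "x \<in> G1" "y \<in> G1" "x * x * y = 1"
      by (auto simp: arc_triples_def)
    have y: "y = inverse (x * x)" using xy(3) by (metis inverse_unique)
    have "arc x \<noteq> None"
    proof
      assume "arc x = None"
      then have "T \<in> exceptional" using T y xy by (auto simp: exceptional_def)
      with assms show False by simp
    qed
    then obtain c where c: "arc x = Some c" by auto
    have "x * y = inverse x" using xy(3) by (metis inverse_unique mult.assoc)
    then have "prod val T = inverse x"
      using arc_ends_distinct(1)[OF xy] by (simp add: T)
    with c xy show ?thesis by (intro arc[of x c]) (auto simp: T)
  next
    case 3
    then obtain x y where T: "T = {Special (rung x), Elem x, Elem y}"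
      and xy: "x \<in> G1" "y \<in> G1" "x * y = 1"
      by (auto simp: rung_triples_def)
    have y: "y = inverse x" using xy(3) by (metis inverse_unique)
    have "rung x = None"
    proof (rule ccontr)
      assume "rung x \<noteq> None"
      then have "T \<in> exceptional" using T y xy unfolding exceptional_def by blast
      with assms show False by simp
    qed
    moreover have "prod val T = 1"
      using rung_ends_distinct(1)[OF xy] xy(3) by (simp add: T)
    ultimately show ?thesis by (intro other) (auto simp: T)
  qed
qed

text \<open>
  The product of all points is \<open>1\<close>, and in a class of ordinary triples only the two triples through
  the points at infinity can differ from \<open>1\<close>. So the arcs in these two triples start at mutually
  inverse elements, although they have different colours.
\<close>
lemma ordinary_parallel_class:
  assumes "parallel_class points triples P" "P \<inter> exceptional = {}"
  obtains x y where "x \<in> G1" "y \<in> G1" "x * y = 1" "arc x = Some False" "arc y = Some True"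
proof -
  have P: "finite P" "\<Union>P = points"
    using parallel_class_covers[OF steiner assms(1)] by (auto simp: points_def)
  have disj: "T = T'" if "T \<in> P" "T' \<in> P" "p \<in> T" "p \<in> T'" for T T' p
    using assms(1) that by (auto simp: parallel_class_def pairwise_def disjnt_iff)
  have ord: "T \<in> triples" "T \<notin> exceptional" if "T \<in> P" for T
    using assms that by (auto simp: parallel_class_def)
  have ex: "\<exists>T x. T \<in> P \<and> x \<in> G1 \<and> arc x = Some c \<and> Special (Some c) \<in> T \<and>
      (\<forall>d. Special (Some d) \<in> T \<longrightarrow> d = c) \<and> prod val T = inverse x" for c
  proof -
    have "Special (Some c) \<in> \<Union>P" using P by (auto simp: points_def)
    then obtain T where T: "T \<in> P" "Special (Some c) \<in> T" by blast
    from ord[OF T(1)] show ?thesis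
    proof (cases rule: ordinary_triple_cases)
      case (arc x d)
      with T have "d = c" by blast
      with arc T show ?thesis by blast
    qed (use T in auto)
  qed
  obtain T x where T: "T \<in> P" "x \<in> G1" "arc x = Some False" "Special (Some False) \<in> T"
      "\<And>d. Special (Some d) \<in> T \<Longrightarrow> d = False" "prod val T = inverse x"
    using ex[of False] by blast
  obtain U y where U: "U \<in> P" "y \<in> G1" "arc y = Some True" "Special (Some True) \<in> U"
      "prod val U = inverse y"
    using ex[of True] by blast
  have "T \<noteq> U" using T U by auto
  \<comment> \<open>Any triple of the class through a point at infinity is \<open>T\<close> or \<open>U\<close>.\<close>
  have one: "prod val W = 1" if "W \<in> P - {T, U}" for W
  proof -
    have "W \<in> P" using that by simp
    from ord[OF this] show ?thesis
    proof (cases rule: ordinary_triple_cases)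
      case (arc z c)
      have "W = T \<or> W = U"
        using arc disj[OF \<open>W \<in> P\<close> T(1) _ T(4)] disj[OF \<open>W \<in> P\<close> U(1) _ U(4)] by (cases c) auto
      with that show ?thesis by auto
    qed
  qed
  have "1 = prod val (\<Union>P)"
    using P prod_val_points by simp
  also have "\<dots> = (\<Prod>W\<in>P. prod val W)"
  proof (rule prod.Union_disjoint[unfolded comp_def])
    show "\<forall>A\<in>P. finite A"
      using triple_points ord by (metis card.infinite zero_neq_numeral)
    show "\<forall>A\<in>P. \<forall>B\<in>P. A \<noteq> B \<longrightarrow> A \<inter> B = {}"
      using disj by blast
  qed
  also have "\<dots> = (\<Prod>W\<in>{T, U}. prod val W)"
    using P T(1) U(1) one by (intro prod.mono_neutral_right) auto
  also have "\<dots> = inverse (x * y)"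
    using \<open>T \<noteq> U\<close> T U by simp
  finally have "x * y = 1" by (metis inverse_eq_1_iff)
  with T U show ?thesis by (intro that)
qed

end

context unit_group
begin

section \<open>Colourings given by a two-colouring of the elements\<close>
definition inverse_invariant :: "(complex \<Rightarrow> bool) \<Rightarrow> bool" where
  "inverse_invariant \<chi> \<longleftrightarrow> (\<forall>x\<in>G. \<chi> (inverse x) = \<chi> x)"

text \<open>
  A two-colouring \<open>\<chi>\<close> that alternated along all squaring orbits would colour the arcs properly, with all
  rungs receiving the third colour. Orbits of odd length make this impossible, and a defect is a place
  where alternation fails.
\<close>
definition defects :: "(complex \<Rightarrow> bool) \<Rightarrow> complex set" where
  "defects \<chi> = {x \<in> G1. \<chi> (x * x) = \<chi> x}"

lemma finite_defects: "finite (defects \<chi>)"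
  using finite_G by (simp add: defects_def)

lemma square_G1: "x \<in> G1 \<Longrightarrow> x * x \<in> G1"
  using mult_in[of x x] square_one[of x] by auto

lemma inverse_invariant_defect:
  assumes "inverse_invariant \<chi>" "x \<in> G"
  shows "inverse x \<in> defects \<chi> \<longleftrightarrow> x \<in> defects \<chi>"
proof -
  have "\<chi> (inverse x) = \<chi> x" "\<chi> (inverse (x * x)) = \<chi> (x * x)"
    using assms mult_in by (auto simp: inverse_invariant_def simp del: inverse_mult_distrib)
  then show ?thesis
    using inverse_in[OF assms(2)] assms(2) by (simp add: defects_def)
qed

text \<open>
  A colouring of the cubic graph is made from \<open>\<chi>\<close> as follows. Away from defects the arc started by \<open>x\<close>
  has colour \<open>\<chi> x\<close> and the rungs have colour \<open>None\<close>. At a defect \<open>x\<close> the colour of the arc is exchanged: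
  the arcs started by \<open>x\<close> and by \<open>inverse x\<close> get \<open>None\<close>, and the two rungs at their ends get the two
  colours at infinity. All exceptional triples come from defects, except the triple of the special points.
  The colouring of the arcs is invariant under inversion, so no parallel class consists of ordinary
  triples only.
\<close>
lemma few_parallel_classes:
  assumes sym: "inverse_invariant \<chi>"
    and isolated: "\<And>x. x \<in> defects \<chi> \<Longrightarrow> x * x \<notin> defects \<chi>"
  shows "\<exists>V B. steiner_triple_system (V :: complex point set) B \<and> card V = card G + 2 \<and>
    (\<forall>\<P>. disjoint_parallel_classes V B \<P> \<longrightarrow> card \<P> \<le> 1 + 3 * card (defects \<chi>))"
proof -
  let ?R = "defects \<chi>"
  define arc where "arc x = (if x \<in> ?R then None else Some (\<chi> x))" for x
  define rung where "rung x = (if x \<in> ?R then Some (\<chi> x)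
    else if rt x \<in> ?R then Some (\<not> \<chi> x) else None)" for x
  have inv: "\<chi> (inverse x) = \<chi> x" if "x \<in> G" for x
    using sym that by (simp add: inverse_invariant_def)
  have inv_R: "inverse x \<in> ?R \<longleftrightarrow> x \<in> ?R" if "x \<in> G" for x
    using sym that by (rule inverse_invariant_defect)
  have head: "rt y = x" "y = inverse (x * x)" "y \<in> ?R \<longleftrightarrow> x * x \<in> ?R" "\<chi> y = \<chi> (x * x)"
    if "x \<in> G1" "y \<in> G1" "x * x * y = 1" for x y
  proof -
    show y: "y = inverse (x * x)" using that(3) by (metis inverse_unique)
    show "rt y = x" using that by (intro rt_eqI) auto
    have "x * x \<in> G" using that mult_in by auto
    from inv_R[OF this] inv[OF this] show "y \<in> ?R \<longleftrightarrow> x * x \<in> ?R" "\<chi> y = \<chi> (x * x)"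
      unfolding y by auto
  qed
  interpret coloured_ladder G arc rung
  proof
    fix x y assume xy: "x \<in> G1" "y \<in> G1"
    show "arc x \<noteq> rung x" using isolated by (auto simp: arc_def rung_def)
    show "rung x = rung y" if "x * y = 1"
    proof -
      have y: "y = inverse x" using that by (metis inverse_unique)
      have "rt y = inverse (rt x)"
      proof (rule rt_eqI)
        have "inverse (rt x * rt x * x) = 1" using rt[OF xy(1)] by simp
        then show "inverse (rt x) * inverse (rt x) * y = 1" by (simp add: y mult_ac)
      qed (use xy rt[OF xy(1)] inverse_in in auto)
      then show ?thesis
        using inv[of x] inv_R[of x] inv_R[of "rt x"] xy rt[OF xy(1)] by (simp add: rung_def y)
    qed
    show "arc x \<noteq> rung y" if "x * x * y = 1"
      using head[OF xy that] isolated[of x] xy square_G1[OF xy(1)]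
      by (auto simp: arc_def rung_def defects_def)
    show "arc x \<noteq> arc y" if "x * x * y = 1"
      using head[OF xy that] isolated[of x] xy square_G1[OF xy(1)]
      by (auto simp: arc_def defects_def)
  qed
  have arc_None: "{x \<in> G1. arc x = None} = ?R"
    by (auto simp: arc_def defects_def)
  have "{x \<in> G1. rung x \<noteq> None} \<subseteq> ?R \<union> (\<lambda>u. inverse (u * u)) ` ?R"
  proof
    fix x assume x: "x \<in> {x \<in> G1. rung x \<noteq> None}"
    then have "x \<in> ?R \<or> rt x \<in> ?R" by (auto simp: rung_def split: if_splits)
    moreover have "x = inverse (rt x * rt x)"
      using rt(2)[of x] x by (metis (no_types, lifting) mem_Collect_eq inverse_unique)
    ultimately show "x \<in> ?R \<union> (\<lambda>u. inverse (u * u)) ` ?R" by blast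
  qed
  then have "card {x \<in> G1. rung x \<noteq> None} \<le> card (?R \<union> (\<lambda>u. inverse (u * u)) ` ?R)"
    using finite_defects by (intro card_mono) auto
  also have "\<dots> \<le> card ?R + card ?R"
    by (intro order.trans[OF card_Un_le] add_left_mono card_image_le finite_defects)
  finally have rung_card: "card {x \<in> G1. rung x \<noteq> None} \<le> card ?R + card ?R" .
  have exc: "exceptional = insert (range Special)
     ((\<lambda>x. {Special None, Elem x, Elem (inverse (x * x))}) ` {x \<in> G1. arc x = None} \<union>
      (\<lambda>x. {Special (rung x), Elem x, Elem (inverse x)}) ` {x \<in> G1. rung x \<noteq> None})"
    (is "_ = insert _ (?f ` ?A \<union> ?g ` ?C)")
    unfolding exceptional_def setcompr_eq_image ..
  have fin: "finite ?A" "finite ?C" using finite_G by auto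
  have "finite exceptional" unfolding exc using fin by simp
  have "card exceptional \<le> Suc (card (?f ` ?A \<union> ?g ` ?C))"
    unfolding exc by (rule card_insert_le_m1[THEN order.trans]) auto
  also have "\<dots> \<le> Suc (card ?A + card ?C)"
    using fin by (intro Suc_le_mono[THEN iffD2] order.trans[OF card_Un_le] add_mono card_image_le)
  also have "\<dots> \<le> 1 + 3 * card ?R"
    using rung_card unfolding arc_None by linarith
  finally have card_exc: "card exceptional \<le> 1 + 3 * card ?R" .
  have meets: "P \<inter> exceptional \<noteq> {}" if "parallel_class points triples P" for P
  proof
    assume "P \<inter> exceptional = {}"
    from ordinary_parallel_class[OF that this] obtain x y where
      *: "x \<in> G1" "x * y = 1" "arc x = Some False" "arc y = Some True" by metis
    have "y = inverse x" using *(2) by (metis inverse_unique)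
    with * inv[of x] show False by (auto simp: arc_def split: if_splits)
  qed
  have "card \<P> \<le> 1 + 3 * card ?R" if "disjoint_parallel_classes points triples \<P>" for \<P>
    using disjoint_classes_le_transversal[OF that \<open>finite exceptional\<close> meets] card_exc by simp
  with steiner card_points show ?thesis by blast
qed

section \<open>A colouring with few defects\<close>
lemma pow2_Suc: "(x :: complex) ^ 2 ^ Suc j = x ^ 2 ^ j * x ^ 2 ^ j"
  by (simp add: mult_2 power_add)

lemma power_eq_or_inverse:
  fixes x y :: complex
  shows "x = y \<or> x = inverse y \<Longrightarrow> x ^ m = y ^ m \<or> x ^ m = inverse (y ^ m)"
  by (auto simp: power_inverse)

lemma square_eq_or_inverse:
  assumes "x \<in> G" "y \<in> G" "x * x = y * y \<or> x * x = inverse (y * y)"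
  shows "x = y \<or> x = inverse y"
  using assms(3)
proof
  assume "x * x = inverse (y * y)"
  then have "x * x = inverse y * inverse y" by simp
  with assms inverse_in have "x = inverse y" by (auto intro: square_inj[of x "inverse y"])
  then show ?thesis ..
next
  assume "x * x = y * y"
  with assms have "x = y" by (auto intro: square_inj[of x y])
  then show ?thesis ..
qed

text \<open>
  Changing \<open>\<chi>\<close> on \<open>x\<^sup>2, x\<^sup>4, \<dots>\<close> up to \<open>x\<close> raised to \<open>2 ^ k\<close>, and on their inverses, affects alternation
  only at the two ends of this segment of the orbit. If both ends are defects, both disappear.
\<close>
lemma annihilate_defects:
  assumes sym: "inverse_invariant \<chi>" and x: "x \<in> defects \<chi>"
    and k: "k \<ge> 1" "x ^ 2 ^ k \<in> defects \<chi>" "\<not> (x ^ 2 ^ k = x \<or> x ^ 2 ^ k = inverse x)"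
  shows "\<exists>\<chi>'. inverse_invariant \<chi>' \<and> card (defects \<chi>') < card (defects \<chi>)"
proof -
  \<comment> \<open>Taking \<open>k\<close> least makes the segment free of inner defects and of returns to \<open>x\<close>.\<close>
  define Q where "Q k \<longleftrightarrow> k \<ge> 1 \<and> x ^ 2 ^ k \<in> defects \<chi> \<and>
    \<not> (x ^ 2 ^ k = x \<or> x ^ 2 ^ k = inverse x)" for k
  define m where "m = (LEAST k. Q k)"
  have "Q k" using k by (simp add: Q_def)
  then have "Q m" and least: "\<And>j. j < m \<Longrightarrow> \<not> Q j"
    unfolding m_def by (auto intro: LeastI dest: not_less_Least)
  define p where "p j = x ^ 2 ^ j" for j
  \<comment> \<open>The orbits are considered modulo inversion, since \<open>\<chi>\<close> cannot distinguish \<open>z\<close> from \<open>inverse z\<close>.\<close>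
  define near where "near z w \<longleftrightarrow> z = w \<or> z = inverse w" for z w :: complex
  have xG: "x \<in> G" using x by (simp add: defects_def)
  have pG: "p j \<in> G" for j unfolding p_def by (rule power_in[OF xG])
  have p0: "p 0 = x" by (simp add: p_def)
  have p_Suc: "p (Suc j) = p j * p j" for j unfolding p_def by (rule pow2_Suc)
  have near_sym: "near z w \<Longrightarrow> near w z" for z w
    by (auto simp: near_def)
  have near_trans: "near z w \<Longrightarrow> near w u \<Longrightarrow> near z u" for z w u
    by (auto simp: near_def)
  have near_square: "near (z * z) (w * w) \<longleftrightarrow> near z w" if "z \<in> G" "w \<in> G" for z w
    using square_eq_or_inverse[OF that] by (auto simp: near_def)
  have near_defect: "z \<in> defects \<chi> \<longleftrightarrow> w \<in> defects \<chi>" if "near z w" "w \<in> G" for z w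
    using that inverse_invariant_defect[OF sym, of w] by (auto simp: near_def)
  have m: "m \<ge> 1" "p m \<in> defects \<chi>" "\<not> near (p m) x"
    using \<open>Q m\<close> by (auto simp: Q_def p_def near_def)
  have no_return: "\<not> near (p j) x" if j: "1 \<le> j" "j \<le> m" for j
  proof
    assume n: "near (p j) x"
    then have "j < m" using j m(3) by (cases "j = m") auto
    \<comment> \<open>A return after \<open>j\<close> steps would make the shorter segment of length \<open>m - j\<close> a candidate.\<close>
    have "p m = p j ^ 2 ^ (m - j)"
      using \<open>j < m\<close> by (simp add: p_def flip: power_mult power_add)
    then have "near (p m) (p (m - j))"
      using power_eq_or_inverse[of "p j" x "2 ^ (m - j)"] n by (simp add: near_def p_def)
    then have "p (m - j) \<in> defects \<chi>" "\<not> near (p (m - j)) x"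
      using m near_defect[OF _ pG] near_trans by blast+
    then have "Q (m - j)" using \<open>j < m\<close> by (simp add: Q_def p_def near_def)
    with least[of "m - j"] j \<open>j < m\<close> show False by simp
  qed
  have no_defect: "p j \<notin> defects \<chi>" if "1 \<le> j" "j < m" for j
    using least[of j] no_return[of j] that by (auto simp: Q_def p_def near_def)
  define F where "F = {z. \<exists>j\<in>{1..m}. near z (p j)}"
  define \<chi>' where "\<chi>' z \<longleftrightarrow> \<chi> z \<noteq> (z \<in> F)" for z
  have F_near: "z \<in> F \<longleftrightarrow> w \<in> F" if "near z w" for z w
    using that near_sym near_trans unfolding F_def by blast
  have sym': "inverse_invariant \<chi>'"
    using sym F_near by (auto simp: inverse_invariant_def \<chi>'_def near_def)
  have xF: "x \<notin> F"
  proof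
    assume "x \<in> F"
    then obtain j where "1 \<le> j" "j \<le> m" "near x (p j)" by (auto simp: F_def)
    with no_return[of j] near_sym[of x "p j"] show False by simp
  qed
  have F_square: "z * z \<in> F \<Longrightarrow> near z x \<or> (\<exists>j. 1 \<le> j \<and> j < m \<and> near z (p j))"
    if "z \<in> G" for z
  proof -
    assume "z * z \<in> F"
    then obtain j where j: "1 \<le> j" "j \<le> m" "near (z * z) (p j)" by (auto simp: F_def)
    then obtain i where i: "j = Suc i" by (cases j) auto
    then have "near z (p i)" using j near_square[OF that pG] by (simp add: p_Suc)
    then show ?thesis using i j p0 by (cases "i = 0") auto
  qed
  have F_square': "z * z \<in> F" if "z \<in> G" "near z (p j)" "j < m" for z j
    using that near_square[OF _ pG] by (auto simp: F_def p_Suc intro!: bexI[of _ "Suc j"])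
  have "z \<in> defects \<chi> \<and> \<not> near z x" if z: "z \<in> defects \<chi>'" for z
  proof -
    have zG: "z \<in> G" "z \<in> G1" using z by (auto simp: defects_def)
    have zz: "(\<chi> (z * z) \<noteq> (z * z \<in> F)) = (\<chi> z \<noteq> (z \<in> F))"
      using z by (simp add: defects_def \<chi>'_def)
    have "\<not> near z x"
    proof
      assume n: "near z x"
      then have "z \<notin> F" "z * z \<in> F" "\<chi> (z * z) = \<chi> z"
        using xF F_near n F_square'[of z 0] zG m(1) near_defect[OF n xG] x p0
        by (auto simp: defects_def)
      with zz show False by simp
    qed
    moreover have "\<not> near z (p m)"
    proof
      assume n: "near z (p m)"
      then have "z \<in> F" "\<chi> (z * z) = \<chi> z"
        using m near_defect[OF n pG] by (auto simp: F_def defects_def)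
      with zz have "z * z \<in> F" by (cases "\<chi> z") auto
      then obtain j where j: "1 \<le> j" "j < m" "near z (p j)"
        using F_square zG \<open>\<not> near z x\<close> by blast
      then have "near (p m) (p j)" using n near_sym near_trans by blast
      then show False using near_defect[OF _ pG] m(2) no_defect j by blast
    qed
    moreover have "z \<in> defects \<chi>"
    proof -
      have "z * z \<in> F \<longleftrightarrow> z \<in> F"
      proof
        assume "z * z \<in> F"
        with F_square zG \<open>\<not> near z x\<close> show "z \<in> F" by (fastforce simp: F_def)
      next
        assume "z \<in> F"
        then obtain j where "j \<in> {1..m}" "near z (p j)" by (auto simp: F_def)
        moreover from this have "j \<noteq> m" using \<open>\<not> near z (p m)\<close> by auto
        ultimately show "z * z \<in> F" using F_square'[OF zG(1)] by auto
      qed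
      with zz zG show ?thesis by (cases "z \<in> F") (auto simp: defects_def)
    qed
    ultimately show ?thesis by blast
  qed
  then have "defects \<chi>' \<subset> defects \<chi>"
    using x by (auto simp: near_def)
  with sym' show ?thesis
    by (intro exI[of _ \<chi>'] conjI psubset_card_mono finite_defects)
qed

text \<open>
  A colouring with the least number of defects has at most one defect, up to inversion, on each
  squaring orbit.
\<close>
lemma separated_defects_exist:
  obtains \<chi> where "inverse_invariant \<chi>"
    "\<And>x k. \<lbrakk>x \<in> defects \<chi>; k \<ge> 1; x ^ 2 ^ k \<in> defects \<chi>\<rbrakk> \<Longrightarrow> x ^ 2 ^ k = x \<or> x ^ 2 ^ k = inverse x"
proof -
  have "inverse_invariant (\<lambda>_. True)" by (simp add: inverse_invariant_def)
  from ex_has_least_nat[of inverse_invariant, OF this, of "\<lambda>\<chi>. card (defects \<chi>)"]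
  obtain \<chi> where \<chi>: "inverse_invariant \<chi>"
    "\<And>\<chi>'. inverse_invariant \<chi>' \<Longrightarrow> card (defects \<chi>) \<le> card (defects \<chi>')"
    by blast
  show ?thesis
  proof (rule that[OF \<chi>(1)], rule ccontr)
    fix x k assume "x \<in> defects \<chi>" "k \<ge> 1" "x ^ 2 ^ k \<in> defects \<chi>"
      "\<not> (x ^ 2 ^ k = x \<or> x ^ 2 ^ k = inverse x)"
    from annihilate_defects[OF \<chi>(1) this] \<chi>(2) show False
      by (auto simp flip: not_le)
  qed
qed

text \<open>
  An element that returns to itself or its inverse after \<open>l\<close> squarings is a root of unity of order
  dividing \<open>2 ^ l - 1\<close> or \<open>2 ^ l + 1\<close>, and the number of these does not depend on the group.
\<close>
lemma card_short_orbits: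
  "card {x \<in> G. \<exists>l\<in>{1..<L}. x ^ 2 ^ l = x \<or> x ^ 2 ^ l = inverse x} \<le> 2 ^ (L + 1)"
proof -
  let ?A = "\<lambda>l::nat. {x :: complex. x ^ (2 ^ l - 1) = 1}" and ?B = "\<lambda>l::nat. {x :: complex. x ^ (2 ^ l + 1) = 1}"
  have fin: "finite (?A l)" "finite (?B l)" if "l \<ge> 1" for l
  proof -
    have "(2::nat) ^ l > 1" using that by (intro one_less_power) auto
    then show "finite (?A l)" "finite (?B l)" by (intro finite_roots_unity; simp)+
  qed
  have sub: "{x \<in> G. \<exists>l\<in>{1..<L}. x ^ 2 ^ l = x \<or> x ^ 2 ^ l = inverse x} \<subseteq> (\<Union>l\<in>{1..<L}. ?A l \<union> ?B l)"
  proof safe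
    fix x l assume x: "x \<in> G" and l: "l \<in> {1..<L}" "x ^ 2 ^ l = x"
    have "x ^ (2 ^ l - 1) * x = x"
      using l(2) by (simp flip: power_Suc2)
    then have "x \<in> ?A l" using nonzero[OF x] by simp
    with l show "x \<in> (\<Union>l\<in>{1..<L}. ?A l \<union> ?B l)" by blast
  next
    fix x l assume x: "x \<in> G" and l: "l \<in> {1..<L}" "x ^ 2 ^ l = inverse x"
    have "x \<in> ?B l" using l(2) nonzero[OF x] by simp
    with l show "x \<in> (\<Union>l\<in>{1..<L}. ?A l \<union> ?B l)" by blast
  qed
  have one: "card (?A l \<union> ?B l) \<le> 2 ^ (l + 1)" if "l \<ge> 1" for l
  proof -
    have "(2::nat) ^ l > 1" using that by (intro one_less_power) auto
    then have "card (?A l) \<le> 2 ^ l - 1" "card (?B l) \<le> 2 ^ l + 1"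
      by (intro card_roots_unity; simp)+
    then show ?thesis
      using card_Un_le[of "?A l" "?B l"] \<open>(2::nat) ^ l > 1\<close> by (simp add: mult_2)
  qed
  have "card {x \<in> G. \<exists>l\<in>{1..<L}. x ^ 2 ^ l = x \<or> x ^ 2 ^ l = inverse x} \<le> card (\<Union>l\<in>{1..<L}. ?A l \<union> ?B l)"
    using fin by (intro card_mono sub) auto
  also have "\<dots> \<le> (\<Sum>l\<in>{1..<L}. card (?A l \<union> ?B l))"
    by (rule card_UN_le) simp
  also have "\<dots> \<le> (\<Sum>l\<in>{1..<L}. 2 ^ (l + 1))"
    by (intro sum_mono one) auto
  also have "\<dots> \<le> 2 ^ (L + 1)"
    by (induction L) (auto simp: atLeastLessThanSuc)
  finally show ?thesis .
qed

text \<open>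
  Elements of \<open>R\<close> on long orbits have disjoint segments \<open>x, x\<^sup>2, x\<^sup>4, \<dots>\<close> of length \<open>L\<close>, so there are at most
  \<open>card G / L\<close> of them; the others are counted by \<open>card_short_orbits\<close>.
\<close>
lemma card_separated_set:
  assumes "R \<subseteq> G" "L \<ge> 1"
    and sep: "\<And>x k. \<lbrakk>x \<in> R; k \<ge> 1; x ^ 2 ^ k \<in> R\<rbrakk> \<Longrightarrow> x ^ 2 ^ k = x \<or> x ^ 2 ^ k = inverse x"
  shows "real (card R) \<le> 2 ^ (L + 1) + real (card G) / real L"
proof -
  define S where "S = {x \<in> G. \<exists>l\<in>{1..<L}. x ^ 2 ^ l = x \<or> x ^ 2 ^ l = inverse x}"
  have wlog: "x = y \<and> i = j"
    if "x \<in> R - S" "y \<in> R - S" "j \<le> i" "i < L" "x ^ 2 ^ i = y ^ 2 ^ j" for x y i j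
  proof -
    have split: "x ^ 2 ^ i = (x ^ 2 ^ (i - j)) ^ 2 ^ j"
      using that(3) by (simp flip: power_mult power_add)
    have y: "x ^ 2 ^ (i - j) = y"
    proof (rule pow2_inj)
      show "(x ^ 2 ^ (i - j)) ^ 2 ^ j = y ^ 2 ^ j"
        by (rule trans[OF split[symmetric] that(5)])
    qed (use that(1,2) assms(1) power_in in blast)+
    have "i - j = 0"
    proof (rule ccontr)
      assume "i - j \<noteq> 0"
      then have "x ^ 2 ^ (i - j) = x \<or> x ^ 2 ^ (i - j) = inverse x"
        using sep[of x "i - j"] y that by auto
      then have "x \<in> S" using \<open>i - j \<noteq> 0\<close> that assms(1) unfolding S_def
        by (intro CollectI conjI bexI[of _ "i - j"]) auto
      with that show False by simp
    qed
    with y that show ?thesis by simp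
  qed
  have "inj_on (\<lambda>(x, j). x ^ 2 ^ j) ((R - S) \<times> {..<L})"
  proof (rule inj_onI)
    fix a b assume ab: "a \<in> (R - S) \<times> {..<L}" "b \<in> (R - S) \<times> {..<L}"
      "(case a of (x, j) \<Rightarrow> x ^ 2 ^ j) = (case b of (x, j) \<Rightarrow> x ^ 2 ^ j)"
    obtain x i y j where eq: "a = (x, i)" "b = (y, j)" by (cases a, cases b)
    show "a = b"
      using ab wlog[of x y j i] wlog[of y x i j] unfolding eq by (cases "j \<le> i") auto
  qed
  then have "card ((R - S) \<times> {..<L}) \<le> card G"
    using assms(1) finite_G by (intro card_inj_on_le[of "\<lambda>(x, j). x ^ 2 ^ j"]) (auto intro!: power_in)
  then have "real (card (R - S)) * real L \<le> real (card G)"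
    by (simp add: card_cartesian_product flip: of_nat_mult)
  then have "real (card (R - S)) \<le> real (card G) / real L"
    using assms(2) by (simp add: field_simps)
  moreover have "real (card S) \<le> 2 ^ (L + 1)"
    using of_nat_mono[OF card_short_orbits[of L], where 'a = real] unfolding S_def by simp
  moreover have "card R \<le> card S + card (R - S)"
  proof -
    have "finite S" using finite_G by (simp add: S_def)
    moreover have "finite R" using assms(1) finite_G finite_subset by blast
    ultimately have "card R \<le> card (S \<union> (R - S))" by (intro card_mono) auto
    also have "\<dots> \<le> card S + card (R - S)" by (rule card_Un_le)
    finally show ?thesis .
  qed
  ultimately show ?thesis by linarith
qed

lemma sublinear_parallel_classes:
  assumes "L \<ge> 1"
  shows "\<exists>V B. steiner_triple_system (V :: complex point set) B \<and> card V = card G + 2 \<and>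
    (\<forall>\<P>. disjoint_parallel_classes V B \<P> \<longrightarrow>
      real (card \<P>) \<le> 1 + 3 * (2 ^ (L + 1) + real (card G) / real L))"
proof -
  obtain \<chi> where inv: "inverse_invariant \<chi>" and
    sep: "\<And>x k. \<lbrakk>x \<in> defects \<chi>; k \<ge> 1; x ^ 2 ^ k \<in> defects \<chi>\<rbrakk> \<Longrightarrow> x ^ 2 ^ k = x \<or> x ^ 2 ^ k = inverse x"
    using separated_defects_exist by blast
  have "x * x \<notin> defects \<chi>" if x: "x \<in> defects \<chi>" for x
  proof
    assume "x * x \<in> defects \<chi>"
    with sep[OF x, of 1] have "x * x = x \<or> x * x = inverse x" by (simp add: power2_eq_square)
    moreover have "x \<in> G1" using x by (simp add: defects_def)
    ultimately show False
      using cube_one[of x] nonzero[of x] by (auto simp: field_simps)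
  qed
  from few_parallel_classes[OF inv this] obtain V B where
    VB: "steiner_triple_system (V :: complex point set) B" "card V = card G + 2" and
    bound: "\<And>\<P>. disjoint_parallel_classes V B \<P> \<Longrightarrow> card \<P> \<le> 1 + 3 * card (defects \<chi>)"
    by blast
  have few_defects: "real (card (defects \<chi>)) \<le> 2 ^ (L + 1) + real (card G) / real L"
    using sep assms by (intro card_separated_set) (auto simp: defects_def)
  have "real (card \<P>) \<le> 1 + 3 * (2 ^ (L + 1) + real (card G) / real L)"
    if "disjoint_parallel_classes V B \<P>" for \<P>
  proof -
    have "real (card \<P>) \<le> 1 + 3 * real (card (defects \<chi>))"
      using of_nat_mono[OF bound[OF that], where 'a = real] by simp
    also have "\<dots> \<le> 1 + 3 * (2 ^ (L + 1) + real (card G) / real L)"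
      using few_defects by (intro add_left_mono mult_left_mono) auto
    finally show ?thesis .
  qed
  with VB show ?thesis by blast
qed

end

section \<open>Triple systems on natural numbers and the asymptotic bound\<close>
lemma unit_group_roots_of_unity:
  assumes "n mod 6 = 1"
  shows "unit_group {z :: complex. z ^ n = 1}"
proof -
  obtain q where n: "n = 6 * q + 1"
    using assms by (metis mult_div_mod_eq)
  show ?thesis
  proof
    have "n > 0" using n by simp
    then show "finite {z :: complex. z ^ n = 1}" "(0 :: complex) \<notin> {z. z ^ n = 1}"
      by (simp_all add: finite_roots_unity zero_power)
  next
    fix x :: complex assume x: "x \<in> {z. z ^ n = 1}" "x * x = 1"
    have "n = 2 * (3 * q) + 1" using n by simp
    then have "x ^ n = (x ^ 2) ^ (3 * q) * x" by (simp only: power_add power_mult power_one_right)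
    with x show "x = 1" by (simp add: power2_eq_square)
  next
    fix x :: complex assume x: "x \<in> {z. z ^ n = 1}" "x * x * x = 1"
    have "n = 3 * (2 * q) + 1" using n by simp
    then have "x ^ n = (x ^ 3) ^ (2 * q) * x" by (simp only: power_add power_mult power_one_right)
    with x show "x = 1" by (simp add: power3_eq_cube)
  qed (simp_all add: power_mult_distrib power_inverse)
qed

lemma steiner_triple_system_image:
  assumes "inj_on f V" "steiner_triple_system V B"
  shows "steiner_triple_system (f ` V) ((`) f ` B)"
proof -
  have V: "finite V" and B: "\<And>T. T \<in> B \<Longrightarrow> T \<subseteq> V \<and> card T = 3"
    and ex1: "\<And>x y. \<lbrakk>x \<in> V; y \<in> V; x \<noteq> y\<rbrakk> \<Longrightarrow> \<exists>!T. T \<in> B \<and> {x, y} \<subseteq> T"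
    using assms(2) by (auto simp: steiner_triple_system_def)
  have mem: "f z \<in> f ` T \<longleftrightarrow> z \<in> T" if "T \<in> B" "z \<in> V" for T z
    using inj_on_image_mem_iff[OF assms(1) that(2)] B that(1) by blast
  show ?thesis
    unfolding steiner_triple_system_def
  proof (intro conjI ballI impI)
    show "finite (f ` V)" using V by simp
  next
    fix T' assume "T' \<in> (`) f ` B"
    then obtain T where T: "T \<in> B" "T' = f ` T" by auto
    then show "T' \<subseteq> f ` V" using B by auto
    have "inj_on f T" using assms(1) B[OF T(1)] inj_on_subset by blast
    then show "card T' = 3" using T B by (simp add: card_image)
  next
    fix x' y' assume *: "x' \<in> f ` V" "y' \<in> f ` V" "x' \<noteq> y'"
    obtain x where x: "x \<in> V" "x' = f x" using *(1) by blast
    obtain y where y: "y \<in> V" "y' = f y" using *(2) by blast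
    have "x \<noteq> y"
    proof
      assume "x = y"
      then show False using *(3) unfolding x(2) y(2) by simp
    qed
    note xy = x(1) y(1) this x(2) y(2)
    have "\<exists>T. (T \<in> B \<and> {x, y} \<subseteq> T) \<and> (\<forall>U. U \<in> B \<and> {x, y} \<subseteq> U \<longrightarrow> U = T)"
      using ex1[OF xy(1-3)] by (simp only: Ex1_def)
    then obtain T where T: "T \<in> B \<and> {x, y} \<subseteq> T"
      and uniq: "\<forall>U. U \<in> B \<and> {x, y} \<subseteq> U \<longrightarrow> U = T"
      by (rule exE) (erule conjE, rule that)
    show "\<exists>!T'. T' \<in> (`) f ` B \<and> {x', y'} \<subseteq> T'"
    proof (rule ex1I[of _ "f ` T"])
      show "f ` T \<in> (`) f ` B \<and> {x', y'} \<subseteq> f ` T" using T xy by auto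
    next
      fix U' assume "U' \<in> (`) f ` B \<and> {x', y'} \<subseteq> U'"
      then obtain U where U: "U \<in> B" "U' = f ` U" "f x \<in> f ` U" "f y \<in> f ` U"
        using xy by blast
      then have "{x, y} \<subseteq> U" using mem[OF U(1)] xy by simp
      with uniq U show "U' = f ` T" by blast
    qed
  qed
qed

lemma disjoint_parallel_classes_image:
  assumes inj: "inj_on f V" and B: "\<And>T. T \<in> B \<Longrightarrow> T \<subseteq> V"
    and "disjoint_parallel_classes V B \<P>"
  shows "disjoint_parallel_classes (f ` V) ((`) f ` B) ((`) ((`) f) ` \<P>)"
    and "card ((`) ((`) f) ` \<P>) = card \<P>"
proof -
  have pc: "P \<subseteq> B" "pairwise disjnt P" "3 * card P = card V" if "P \<in> \<P>" for P
    using assms(3) that by (auto simp: disjoint_parallel_classes_def parallel_class_def)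
  have inj2: "inj_on ((`) f) B"
    using inj B by (auto intro!: inj_onI simp: inj_on_image_eq_iff)
  have disj: "disjnt (f ` S) (f ` T)" if "S \<in> B" "T \<in> B" "disjnt S T" for S T
    using that B inj by (auto simp: disjnt_def simp flip: inj_on_image_Int)
  have disj2: "disjnt ((`) f ` P) ((`) f ` Q)" if "P \<in> \<P>" "Q \<in> \<P>" "disjnt P Q" for P Q
    using that pc(1) inj2 by (auto simp: disjnt_def simp flip: inj_on_image_Int)
  show "disjoint_parallel_classes (f ` V) ((`) f ` B) ((`) ((`) f) ` \<P>)"
    unfolding disjoint_parallel_classes_def
  proof (intro conjI ballI)
    fix P' assume "P' \<in> (`) ((`) f) ` \<P>"
    then obtain P where P: "P \<in> \<P>" "P' = (`) f ` P" by auto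
    have "card P' = card P"
      unfolding P(2) using inj2 pc(1)[OF P(1)] by (intro card_image) (rule inj_on_subset)
    moreover have "pairwise disjnt P'"
    proof (rule pairwiseI)
      fix S' T' assume *: "S' \<in> P'" "T' \<in> P'" "S' \<noteq> T'"
      obtain S where S: "S \<in> P" "S' = f ` S" using *(1) P(2) by blast
      obtain T where T: "T \<in> P" "T' = f ` T" using *(2) P(2) by blast
      have "S \<noteq> T" using *(3) S(2) T(2) by blast
      then have "disjnt S T" using pc(2)[OF P(1)] S(1) T(1) by (simp add: pairwise_def)
      then show "disjnt S' T'" unfolding S(2) T(2) using disj pc(1)[OF P(1)] S(1) T(1) by blast
    qed
    ultimately show "parallel_class (f ` V) ((`) f ` B) P'"
      using pc[OF P(1)] P(2) inj by (auto simp: parallel_class_def card_image)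
  next
    show "pairwise disjnt ((`) ((`) f) ` \<P>)"
    proof (rule pairwiseI)
      fix P' Q' assume *: "P' \<in> (`) ((`) f) ` \<P>" "Q' \<in> (`) ((`) f) ` \<P>" "P' \<noteq> Q'"
      obtain P where P: "P \<in> \<P>" "P' = (`) f ` P" using *(1) by blast
      obtain Q where Q: "Q \<in> \<P>" "Q' = (`) f ` Q" using *(2) by blast
      have "P \<noteq> Q" using *(3) P(2) Q(2) by blast
      then have "disjnt P Q"
        using assms(3) P(1) Q(1) by (simp add: disjoint_parallel_classes_def pairwise_def)
      then show "disjnt P' Q'" unfolding P(2) Q(2) by (rule disj2[OF P(1) Q(1)])
    qed
  qed
  have "inj_on ((`) ((`) f)) \<P>"
    using pc(1) inj2 by (auto intro!: inj_onI simp: inj_on_image_eq_iff)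
  then show "card ((`) ((`) f) ` \<P>) = card \<P>" by (rule card_image)
qed

lemma few_parallel_classes_on_nat:
  assumes "v mod 6 = 3" "L \<ge> 1"
  shows "\<exists>(V :: nat set) B. steiner_triple_system V B \<and> card V = v \<and>
    (\<forall>\<P>. disjoint_parallel_classes V B \<P> \<longrightarrow> real (card \<P>) \<le> 1 + 3 * (2 ^ (L + 1) + real v / real L))"
proof -
  obtain q where q: "v = 6 * q + 3"
    using assms(1) by (metis mult_div_mod_eq)
  then have v: "v \<ge> 3" by simp
  have "v - 2 = 1 + 6 * q" using q by simp
  then have "(v - 2) mod 6 = 1" by (simp only: mod_mult_self2) simp
  then interpret unit_group "{z. z ^ (v - 2) = 1}" by (rule unit_group_roots_of_unity)
  have card: "card {z :: complex. z ^ (v - 2) = 1} = v - 2"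
    using v by (intro card_roots_unity_eq) auto
  obtain W C where W: "steiner_triple_system (W :: complex point set) C" "card W = v" and
    bound: "\<And>\<P>. disjoint_parallel_classes W C \<P> \<Longrightarrow>
      real (card \<P>) \<le> 1 + 3 * (2 ^ (L + 1) + real (v - 2) / real L)"
    using sublinear_parallel_classes[OF assms(2)] v unfolding card by auto
  have fin: "finite W" using W by (simp add: steiner_triple_system_def)
  then obtain f :: "complex point \<Rightarrow> nat" where f: "inj_on f W"
    using finite_imp_inj_to_nat_seg by metis
  let ?V = "f ` W" and ?B = "(`) f ` C" and ?g = "inv_into W f"
  have sts: "steiner_triple_system ?V ?B" by (rule steiner_triple_system_image[OF f W(1)])
  have C: "T \<subseteq> W" if "T \<in> C" for T using W that by (auto simp: steiner_triple_system_def)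
  have g_V: "?g ` ?V = W" using f by (simp add: inv_into_image_cancel)
  have "(`) ?g ` ?B = (\<lambda>T. T) ` C"
    unfolding image_image[of "(`) ?g"]
    by (rule image_cong[OF refl]) (rule inv_into_image_cancel[OF f C])
  then have g_B: "(`) ?g ` ?B = C" by simp
  have "real (card \<P>) \<le> 1 + 3 * (2 ^ (L + 1) + real v / real L)"
    if P: "disjoint_parallel_classes ?V ?B \<P>" for \<P>
  proof -
    have "inj_on ?g ?V" by (rule inj_on_inv_into) simp
    moreover have "T \<subseteq> ?V" if "T \<in> ?B" for T using that C by auto
    ultimately have "real (card \<P>) \<le> 1 + 3 * (2 ^ (L + 1) + real (v - 2) / real L)"
      using disjoint_parallel_classes_image[of ?g ?V ?B \<P>] P bound unfolding g_V g_B by metis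
    also have "real (v - 2) / real L \<le> real v / real L" by (intro divide_right_mono) auto
    finally show ?thesis by simp
  qed
  moreover have "card ?V = v" using f W by (simp add: card_image)
  ultimately show ?thesis using sts by blast
qed

theorem theorem2:
  shows "\<exists>h :: nat \<Rightarrow> real.
    (\<forall>v. v mod 6 = 3 \<longrightarrow> 0 \<le> h v) \<and>
    ((\<lambda>v. h v / real v) \<longlongrightarrow> 0) at_top_3_mod_6 \<and>
    (\<forall>\<^sub>F v in at_top_3_mod_6.
      \<exists>(V :: nat set) B. steiner_triple_system V B \<and> card V = v \<and>
        (\<forall>\<P>. disjoint_parallel_classes V B \<P> \<longrightarrow> real (card \<P>) \<le> h v))"
proof (intro exI conjI)
  define h where "h v = 1 + 6 * sqrt (real v) + 12 * (real v / log 2 (real v))" for v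
  show "\<forall>v. v mod 6 = 3 \<longrightarrow> 0 \<le> h v"
  proof (intro allI impI)
    fix v :: nat assume "v mod 6 = 3"
    then have "v \<ge> 1" by (cases v) auto
    then show "0 \<le> h v" by (simp add: h_def)
  qed
  have "((\<lambda>v. h v / real v) \<longlongrightarrow> 0) at_top"
    unfolding h_def by real_asymp
  then show "((\<lambda>v. h v / real v) \<longlongrightarrow> 0) at_top_3_mod_6"
    unfolding at_top_3_mod_6_def by (rule tendsto_mono[OF inf_le1])
  have "\<exists>(V :: nat set) B. steiner_triple_system V B \<and> card V = v \<and>
      (\<forall>\<P>. disjoint_parallel_classes V B \<P> \<longrightarrow> real (card \<P>) \<le> h v)"
    if v: "v \<ge> 16" "v mod 6 = 3" for v
  proof -
    define t where "t = log 2 (real v)"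
    have "log 2 (2 ^ 4) \<le> t" unfolding t_def using v(1) by (intro log_mono) auto
    then have t: "t \<ge> 4" by (simp only: log_pow_cancel)
    \<comment> \<open>With \<open>L\<close> about half the binary logarithm of \<open>v\<close>, short orbits cost only \<open>O(sqrt v)\<close>.\<close>
    define L where "L = nat \<lfloor>t / 2\<rfloor>"
    have L: "real L \<le> t / 2" "t / 4 \<le> real L" "L \<ge> 1"
      using t unfolding L_def by linarith+
    have "(2::real) ^ L = 2 powr real L" by (simp add: powr_realpow)
    also have "\<dots> \<le> 2 powr (t / 2)" using L by (intro powr_mono) auto
    also have "\<dots> = (2 powr t) powr (1 / 2)" by (simp add: powr_powr)
    also have "2 powr t = real v" unfolding t_def using v(1) by simp
    also have "real v powr (1 / 2) = sqrt (real v)" by (simp add: powr_half_sqrt)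
    finally have pow: "(2::real) ^ L \<le> sqrt (real v)" .
    have "real v / real L \<le> real v / (t / 4)"
      using L t by (intro divide_left_mono) auto
    with pow have le_h: "1 + 3 * (2 ^ (L + 1) + real v / real L) \<le> h v"
      by (simp add: h_def t_def)
    obtain V :: "nat set" and B where
      "steiner_triple_system V B" "card V = v" and
      "\<And>\<P>. disjoint_parallel_classes V B \<P> \<Longrightarrow>
        real (card \<P>) \<le> 1 + 3 * (2 ^ (L + 1) + real v / real L)"
      using few_parallel_classes_on_nat[OF v(2) L(3)] by blast
    then show ?thesis
      by (intro exI[of _ V] exI[of _ B] conjI allI impI order.trans[OF _ le_h])
  qed
  then show "\<forall>\<^sub>F v in at_top_3_mod_6. \<exists>(V :: nat set) B. steiner_triple_system V B \<and> card V = v \<and>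
      (\<forall>\<P>. disjoint_parallel_classes V B \<P> \<longrightarrow> real (card \<P>) \<le> h v)"
    unfolding at_top_3_mod_6_def eventually_inf_principal
    by (auto intro!: eventually_mono[OF eventually_ge_at_top[of 16]])
qed

end
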